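(* Let $N$ be a right nearring with identity $1$ and let $n\ge 1$. The mapping $P\mapsto P^+$ defines a one-to-one correspondence (bijection) between the set of supplement ideals of $N$ and the set of supplement ideals of $M_n(N)$.
   Context: A right nearring $(N,+,\cdot)$ consists of a (not necessarily abelian) group $(N,+)$ and a semigroup $(N,\cdot)$ with $(a+b)c=ac+bc$ for all $a,b,c\in N$. An ideal of $N$ is a normal subgroup $I$ of $(N,+)$ with $IN\subseteq I$ and $n(n'+i)-nn'\in I$ for all $n,n'\in N$, $i\in I$. An ideal $I$ of a nearring $R$ is a supplement of an ideal $K$ if $I$ is minimal (among ideals) with respect to the property $K+I=R$; a supplement ideal is an ideal that is a supplement of some ideal. $N^n$ is the direct sum of $n$ copies of $(N,+)$. For $a\in N$ and $1\le i,j\le n$, $f_{ij}^a\colon N^n\to N^n$ sends $(x_1,\dots,x_n)$ to the vector with $ax_j$ in position $i$ and $0$ elsewhere. $M_n(N)$ is the subnearring of $M(N^n)$ (all maps $N^n\to N^n$ under pointwise addition and composition) generated by all $f_{ij}^a$, $a\in N$, $1\le i,j\le n$. For an ideal $I$ of $N$, $I^+$ is the ideal of $M_n(N)$ generated by $\{f_{ij}^x\mid x\in I,\ 1\le i,j\le n\}$. *)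

theory Defs
  imports "HOL-Algebra.AbelCoset" "HOL-Algebra.Product_Groups"
begin

(* Nearrings are carried by the ring records of HOL-Algebra.  The record slot one is left
   unconstrained here; an identity is required by additionally assuming monoid N. *)
locale right_nearring = add: group "add_monoid N" for N (structure) +
  assumes mult_closed: "\<lbrakk>a \<in> carrier N; b \<in> carrier N\<rbrakk> \<Longrightarrow> a \<otimes> b \<in> carrier N"
    and mult_assoc: "\<lbrakk>a \<in> carrier N; b \<in> carrier N; c \<in> carrier N\<rbrakk>
          \<Longrightarrow> (a \<otimes> b) \<otimes> c = a \<otimes> (b \<otimes> c)"
    and right_distrib: "\<lbrakk>a \<in> carrier N; b \<in> carrier N; c \<in> carrier N\<rbrakk>
          \<Longrightarrow> (a \<oplus> b) \<otimes> c = a \<otimes> c \<oplus> b \<otimes> c"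

definition nearring_ideal :: "'a set \<Rightarrow> ('a, 'm) ring_scheme \<Rightarrow> bool" where
  "nearring_ideal I N \<longleftrightarrow>
     I \<lhd> add_monoid N \<and>
     (\<forall>i\<in>I. \<forall>n\<in>carrier N. i \<otimes>\<^bsub>N\<^esub> n \<in> I) \<and>
     (\<forall>n\<in>carrier N. \<forall>n'\<in>carrier N. \<forall>i\<in>I.
        n \<otimes>\<^bsub>N\<^esub> (n' \<oplus>\<^bsub>N\<^esub> i) \<ominus>\<^bsub>N\<^esub> n \<otimes>\<^bsub>N\<^esub> n' \<in> I)"

definition subnearring :: "'a set \<Rightarrow> ('a, 'm) ring_scheme \<Rightarrow> bool" where
  "subnearring S N \<longleftrightarrow> subgroup S (add_monoid N) \<and> (\<forall>a\<in>S. \<forall>b\<in>S. a \<otimes>\<^bsub>N\<^esub> b \<in> S)"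

definition is_supplement :: "('a, 'm) ring_scheme \<Rightarrow> 'a set \<Rightarrow> 'a set \<Rightarrow> bool" where
  "is_supplement R K I \<longleftrightarrow>
     nearring_ideal I R \<and> K <+>\<^bsub>R\<^esub> I = carrier R \<and>
     (\<forall>J. nearring_ideal J R \<longrightarrow> J \<subseteq> I \<longrightarrow> K <+>\<^bsub>R\<^esub> J = carrier R \<longrightarrow> J = I)"

definition supplement_ideal :: "'a set \<Rightarrow> ('a, 'm) ring_scheme \<Rightarrow> bool" where
  "supplement_ideal I R \<longleftrightarrow> (\<exists>K. nearring_ideal K R \<and> is_supplement R K I)"

(* M(G) for a (multiplicatively written) group G.  Maps are extensional, i.e. undefined
   outside carrier G, so that equality of maps is HOL equality. *)
definition maps_nearring :: "('a, 'm) monoid_scheme \<Rightarrow> ('a \<Rightarrow> 'a) ring" where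
  "maps_nearring G =
     \<lparr>carrier = carrier G \<rightarrow>\<^sub>E carrier G,
      monoid.mult = compose (carrier G),
      one = (\<lambda>x\<in>carrier G. x),
      ring.zero = (\<lambda>x\<in>carrier G. \<one>\<^bsub>G\<^esub>),
      ring.add = (\<lambda>f g. \<lambda>x\<in>carrier G. f x \<otimes>\<^bsub>G\<^esub> g x)\<rparr>"

(* N^n: vectors are extensional functions on the index set {1..n}. *)
definition power_group :: "('a, 'm) ring_scheme \<Rightarrow> nat \<Rightarrow> (nat \<Rightarrow> 'a) monoid" where
  "power_group N n = product_group {1..n} (\<lambda>_. add_monoid N)"

definition elem_map ::
  "('a, 'm) ring_scheme \<Rightarrow> nat \<Rightarrow> nat \<Rightarrow> nat \<Rightarrow> 'a \<Rightarrow> ((nat \<Rightarrow> 'a) \<Rightarrow> (nat \<Rightarrow> 'a))" where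
  "elem_map N n i j a =
     (\<lambda>x\<in>carrier (power_group N n). \<lambda>k\<in>{1..n}. if k = i then a \<otimes>\<^bsub>N\<^esub> x j else \<zero>\<^bsub>N\<^esub>)"

definition elem_maps ::
  "('a, 'm) ring_scheme \<Rightarrow> nat \<Rightarrow> 'a set \<Rightarrow> ((nat \<Rightarrow> 'a) \<Rightarrow> (nat \<Rightarrow> 'a)) set" where
  "elem_maps N n A = {elem_map N n i j a | i j a. i \<in> {1..n} \<and> j \<in> {1..n} \<and> a \<in> A}"

definition matrix_nearring ::
  "('a, 'm) ring_scheme \<Rightarrow> nat \<Rightarrow> ((nat \<Rightarrow> 'a) \<Rightarrow> (nat \<Rightarrow> 'a)) ring" where
  "matrix_nearring N n =
     (let M = maps_nearring (power_group N n)
      in M\<lparr>carrier := \<Inter>{S. subnearring S M \<and> elem_maps N n (carrier N) \<subseteq> S}\<rparr>)"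

definition ideal_plus ::
  "('a, 'm) ring_scheme \<Rightarrow> nat \<Rightarrow> 'a set \<Rightarrow> ((nat \<Rightarrow> 'a) \<Rightarrow> (nat \<Rightarrow> 'a)) set" where
  "ideal_plus N n I = \<Inter>{J. nearring_ideal J (matrix_nearring N n) \<and> elem_maps N n I \<subseteq> J}"

end

theory Submission
  imports Defs "HOL-Algebra.SndIsomorphismGrp"
begin

text \<open>
  The inverse of \<open>P \<mapsto> P\<^sup>+\<close> sends an ideal \<open>Q\<close> of the matrix nearring to its corner
  \<open>{x. f\<^sub>1\<^sub>1\<^sup>x \<in> Q}\<close>. Corners satisfy \<open>corner (P\<^sup>+) = P\<close> and \<open>(corner Q)\<^sup>+ \<subseteq> Q\<close>; the latter inclusion
  may be strict, but both operations turn a pair of ideals with sum the whole nearring into such a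
  pair, so the minimality of a supplement \<open>Q\<close> forces equality.
\<close>

subsection \<open>Ideals and subnearrings\<close>

context right_nearring
begin

text \<open>Addition need not be commutative, so the laws come from the group
  \<open>add_monoid N\<close>, restated in additive notation.\<close>

lemmas a_closed [simp, intro] = add.m_closed [simplified]
lemmas zero_closed [simp, intro] = add.one_closed [simplified]
lemmas a_inv_closed [simp, intro] = add.inv_closed [simplified, folded a_inv_def]
lemmas l_zero [simp] = add.l_one [simplified]
lemmas r_zero [simp] = add.r_one [simplified]
lemmas l_neg = add.l_inv [simplified, folded a_inv_def]
lemmas r_neg = add.r_inv [simplified, folded a_inv_def]
lemmas a_assoc = add.m_assoc [simplified]
lemmas minus_zero [simp] = add.inv_one [simplified, folded a_inv_def]
lemmas minus_minus [simp] = add.inv_inv [simplified, folded a_inv_def]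
lemmas minus_add = add.inv_mult_group [simplified, folded a_inv_def]
lemmas minus_equality = add.inv_equality [simplified, folded a_inv_def]
lemmas add_eq_self_iff = add.l_cancel_one [simplified]

declare mult_closed [simp, intro]

lemma minus_closed [simp, intro]: "a \<in> carrier N \<Longrightarrow> b \<in> carrier N \<Longrightarrow> a \<ominus> b \<in> carrier N"
  by (simp add: a_minus_def)

lemma minus_zero_right [simp]: "a \<in> carrier N \<Longrightarrow> a \<ominus> \<zero> = a"
  by (simp add: a_minus_def)

lemma minus_add_minus:
  assumes "a \<in> carrier N" "b \<in> carrier N" "c \<in> carrier N"
  shows "(a \<ominus> b) \<oplus> (b \<ominus> c) = a \<ominus> c"
proof -
  have "(a \<ominus> b) \<oplus> (b \<ominus> c) = a \<oplus> ((\<ominus> b \<oplus> b) \<oplus> \<ominus> c)"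
    using assms by (simp add: a_minus_def a_assoc del: l_zero)
  then show ?thesis
    using assms by (simp add: a_minus_def l_neg)
qed

lemma zero_mult [simp]:
  assumes "a \<in> carrier N"
  shows "\<zero> \<otimes> a = \<zero>"
proof -
  have "\<zero> \<otimes> a \<oplus> \<zero> \<otimes> a = \<zero> \<otimes> a"
    using assms right_distrib [of \<zero> \<zero> a] by simp
  then show ?thesis
    using assms by (simp add: add_eq_self_iff)
qed

lemma minus_mult:
  assumes "a \<in> carrier N" "b \<in> carrier N"
  shows "(\<ominus> a) \<otimes> b = \<ominus> (a \<otimes> b)"
proof (rule minus_equality [symmetric])
  show "(\<ominus> a) \<otimes> b \<oplus> a \<otimes> b = \<zero>"
    using assms by (simp add: right_distrib [symmetric] l_neg)
qed (use assms in auto)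

section \<open>Ideals: elementwise criterion, intersections, sums\<close>

lemma nearring_idealI:
  assumes "I \<subseteq> carrier N" "\<zero> \<in> I"
    and "\<And>a b. a \<in> I \<Longrightarrow> b \<in> I \<Longrightarrow> a \<oplus> b \<in> I"
    and "\<And>a. a \<in> I \<Longrightarrow> \<ominus> a \<in> I"
    and "\<And>x a. x \<in> carrier N \<Longrightarrow> a \<in> I \<Longrightarrow> x \<oplus> a \<ominus> x \<in> I"
    and "\<And>a x. a \<in> I \<Longrightarrow> x \<in> carrier N \<Longrightarrow> a \<otimes> x \<in> I"
    and "\<And>x y a. x \<in> carrier N \<Longrightarrow> y \<in> carrier N \<Longrightarrow> a \<in> I \<Longrightarrow> x \<otimes> (y \<oplus> a) \<ominus> x \<otimes> y \<in> I"
  shows "nearring_ideal I N"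
proof -
  have "subgroup I (add_monoid N)"
    using assms(1-4) by unfold_locales (auto simp flip: a_inv_def)
  then show ?thesis
    using assms(5-7)
    by (auto simp: nearring_ideal_def add.normal_inv_iff a_minus_def simp flip: a_inv_def)
qed

lemma nearring_idealD:
  assumes "nearring_ideal I N"
  shows nearring_ideal_subset: "I \<subseteq> carrier N"
    and nearring_ideal_zero: "\<zero> \<in> I"
    and nearring_ideal_add: "a \<in> I \<Longrightarrow> b \<in> I \<Longrightarrow> a \<oplus> b \<in> I"
    and nearring_ideal_uminus: "a \<in> I \<Longrightarrow> \<ominus> a \<in> I"
    and nearring_ideal_conj: "x \<in> carrier N \<Longrightarrow> a \<in> I \<Longrightarrow> x \<oplus> a \<ominus> x \<in> I"
    and nearring_ideal_right: "a \<in> I \<Longrightarrow> x \<in> carrier N \<Longrightarrow> a \<otimes> x \<in> I"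
    and nearring_ideal_left:
      "x \<in> carrier N \<Longrightarrow> y \<in> carrier N \<Longrightarrow> a \<in> I \<Longrightarrow> x \<otimes> (y \<oplus> a) \<ominus> x \<otimes> y \<in> I"
proof -
  have I: "subgroup I (add_monoid N)"
      "\<forall>x\<in>carrier N. \<forall>a\<in>I. x \<oplus> a \<oplus> inv\<^bsub>add_monoid N\<^esub> x \<in> I"
    using assms by (auto simp: nearring_ideal_def add.normal_inv_iff)
  show "I \<subseteq> carrier N" "\<zero> \<in> I" "a \<in> I \<Longrightarrow> b \<in> I \<Longrightarrow> a \<oplus> b \<in> I"
    using subgroup.subset [OF I(1)] subgroup.one_closed [OF I(1)] subgroup.m_closed [OF I(1)]
    by auto
  show "a \<in> I \<Longrightarrow> \<ominus> a \<in> I"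
    using subgroup.m_inv_closed [OF I(1)] by (simp add: a_inv_def)
  show "x \<in> carrier N \<Longrightarrow> a \<in> I \<Longrightarrow> x \<oplus> a \<ominus> x \<in> I"
    using I(2) by (auto simp: a_minus_def a_inv_def)
  show "a \<in> I \<Longrightarrow> x \<in> carrier N \<Longrightarrow> a \<otimes> x \<in> I"
    "x \<in> carrier N \<Longrightarrow> y \<in> carrier N \<Longrightarrow> a \<in> I \<Longrightarrow> x \<otimes> (y \<oplus> a) \<ominus> x \<otimes> y \<in> I"
    using assms by (auto simp: nearring_ideal_def)
qed

text \<open>Without zero-symmetry, an ideal absorbs from the left only those elements that kill zero.\<close>

lemma nearring_ideal_left_mult:
  assumes "nearring_ideal I N" "x \<in> carrier N" "x \<otimes> \<zero> = \<zero>" "a \<in> I"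
  shows "x \<otimes> a \<in> I"
  using nearring_ideal_left [OF assms(1,2) zero_closed assms(4)] nearring_ideal_subset [OF assms(1)]
    assms by (auto simp: subset_iff)

lemma nearring_ideal_carrier: "nearring_ideal (carrier N) N"
  by (rule nearring_idealI) auto

lemma nearring_ideal_Inter:
  assumes "\<And>I. I \<in> \<I> \<Longrightarrow> nearring_ideal I N" "\<I> \<noteq> {}"
  shows "nearring_ideal (\<Inter>\<I>) N"
proof (rule nearring_idealI)
  show "\<Inter>\<I> \<subseteq> carrier N"
    using assms nearring_ideal_subset by blast
qed (use assms in \<open>auto intro: nearring_idealD\<close>)

text \<open>For the left condition, the argument \<open>y\<close> is changed first by
  \<open>a\<close> and then by \<open>b\<close>. The two changes of the value lie in
  \<open>A\<close> and in \<open>B\<close>, and normality brings them into the order of the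
  sum.\<close>

lemma nearring_ideal_set_add:
  assumes A: "nearring_ideal A N" and B: "nearring_ideal B N"
  shows "nearring_ideal (A <+>\<^bsub>N\<^esub> B) N"
  unfolding nearring_ideal_def
proof (intro conjI ballI)
  note sub = nearring_ideal_subset [OF A] nearring_ideal_subset [OF B]
  show "A <+>\<^bsub>N\<^esub> B \<lhd> add_monoid N"
    unfolding set_add_def
    using A B by (intro add.normal_subgroup_set_mult_closed) (auto simp: nearring_ideal_def)
  fix c assume "c \<in> A <+>\<^bsub>N\<^esub> B"
  then obtain a b where c: "c = a \<oplus> b" and ab: "a \<in> A" "b \<in> B"
    by (auto simp: set_add_def')
  have [simp]: "a \<in> carrier N" "b \<in> carrier N"
    using ab sub by auto
  fix x assume [simp]: "x \<in> carrier N"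
  have "c \<otimes> x = a \<otimes> x \<oplus> b \<otimes> x"
    by (simp add: c right_distrib)
  moreover have "a \<otimes> x \<in> A" "b \<otimes> x \<in> B"
    using ab by (auto intro: nearring_ideal_right A B)
  ultimately show "c \<otimes> x \<in> A <+>\<^bsub>N\<^esub> B"
    by (auto simp: set_add_def')
next
  note sub = nearring_ideal_subset [OF A] nearring_ideal_subset [OF B]
  fix x y c assume [simp]: "x \<in> carrier N" "y \<in> carrier N" and "c \<in> A <+>\<^bsub>N\<^esub> B"
  then obtain a b where c: "c = a \<oplus> b" and ab: "a \<in> A" "b \<in> B"
    by (auto simp: set_add_def')
  have [simp]: "a \<in> carrier N" "b \<in> carrier N"
    using ab sub by auto
  define p where "p = x \<otimes> (y \<oplus> a) \<ominus> x \<otimes> y"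
  define q where "q = x \<otimes> ((y \<oplus> a) \<oplus> b) \<ominus> x \<otimes> (y \<oplus> a)"
  have p: "p \<in> A" and q: "q \<in> B"
    using ab nearring_ideal_left [OF A] nearring_ideal_left [OF B] by (auto simp: p_def q_def)
  have [simp]: "p \<in> carrier N" "q \<in> carrier N"
    using p q sub by auto
  have "x \<otimes> (y \<oplus> c) \<ominus> x \<otimes> y = q \<oplus> p"
    unfolding p_def q_def by (subst minus_add_minus) (auto simp: c a_assoc)
  \<comment> \<open>Telescoping yields the summand from \<open>B\<close> first; conjugating
    \<open>q\<close> by \<open>\<ominus> p\<close> moves it behind \<open>p\<close> without leaving
    \<open>B\<close>.\<close>
  also have "q \<oplus> p = p \<oplus> (\<ominus> p \<oplus> q \<ominus> (\<ominus> p))"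
    by (simp add: a_minus_def a_assoc [symmetric] r_neg)
  finally show "x \<otimes> (y \<oplus> c) \<ominus> x \<otimes> y \<in> A <+>\<^bsub>N\<^esub> B"
    using p nearring_ideal_conj [OF B, of "\<ominus> p" q] q by (auto simp: set_add_def')
qed

lemma set_add_mono:
  "A \<subseteq> A' \<Longrightarrow> B \<subseteq> B' \<Longrightarrow> A <+>\<^bsub>N\<^esub> B \<subseteq> A' <+>\<^bsub>N\<^esub> B'"
  by (auto simp: set_add_def')

lemma set_add_subset: "nearring_ideal A N \<Longrightarrow> nearring_ideal B N \<Longrightarrow> A <+>\<^bsub>N\<^esub> B \<subseteq> carrier N"
  using nearring_ideal_subset nearring_ideal_set_add by blast

section \<open>Congruence modulo an ideal\<close>

text \<open>With \<open>x \<ominus> x' \<in> I\<close> read as congruence modulo \<open>I\<close>,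
  the difference of the sums is the conjugate of \<open>y \<ominus> y'\<close> by \<open>x\<close>,
  plus \<open>x \<ominus> x'\<close>.\<close>

lemma minus_mem_add:
  assumes I: "nearring_ideal I N"
    and [simp]: "x \<in> carrier N" "x' \<in> carrier N" "y \<in> carrier N" "y' \<in> carrier N"
    and xy: "x \<ominus> x' \<in> I" "y \<ominus> y' \<in> I"
  shows "(x \<oplus> y) \<ominus> (x' \<oplus> y') \<in> I"
proof -
  have "(x \<oplus> (y \<ominus> y') \<ominus> x) \<oplus> (x \<ominus> x') = x \<oplus> (y \<ominus> y') \<ominus> x'"
    by (rule minus_add_minus) auto
  also have "\<dots> = (x \<oplus> y) \<ominus> (x' \<oplus> y')"
    by (simp add: a_minus_def a_assoc minus_add)
  finally show ?thesis
    using nearring_ideal_add [OF I nearring_ideal_conj [OF I _ xy(2), of x] xy(1)] by simp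
qed

text \<open>Conjugation by \<open>\<ominus> x'\<close> turns the given difference into
  \<open>\<ominus> x' \<oplus> x\<close>, whose negative is the required element.\<close>

lemma minus_mem_uminus:
  assumes I: "nearring_ideal I N"
    and [simp]: "x \<in> carrier N" "x' \<in> carrier N"
    and x: "x \<ominus> x' \<in> I"
  shows "\<ominus> x \<ominus> \<ominus> x' \<in> I"
proof -
  have "\<ominus> x' \<oplus> (x \<ominus> x') \<ominus> \<ominus> x' = \<ominus> x' \<oplus> x"
    by (simp add: a_minus_def a_assoc l_neg)
  then have "\<ominus> x' \<oplus> x \<in> I"
    using nearring_ideal_conj [OF I _ x, of "\<ominus> x'"] by simp
  from nearring_ideal_uminus [OF I this] show ?thesis
    by (simp add: a_minus_def minus_add)
qed

text \<open>The left condition on ideals adds an element of \<open>I\<close> on the right of the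
  argument. Here \<open>x\<close> is \<open>x'\<close> plus \<open>\<ominus> x' \<oplus> x\<close>,
  a conjugate of \<open>x \<ominus> x'\<close>.\<close>

lemma minus_mem_mult:
  assumes I: "nearring_ideal I N"
    and [simp]: "a \<in> carrier N" "x \<in> carrier N" "x' \<in> carrier N"
    and x: "x \<ominus> x' \<in> I"
  shows "a \<otimes> x \<ominus> a \<otimes> x' \<in> I"
proof -
  have "\<ominus> x' \<oplus> (x \<ominus> x') \<ominus> \<ominus> x' = \<ominus> x' \<oplus> x"
    by (simp add: a_minus_def a_assoc l_neg)
  then have mem: "\<ominus> x' \<oplus> x \<in> I"
    using nearring_ideal_conj [OF I _ x, of "\<ominus> x'"] by simp
  have "x' \<oplus> (\<ominus> x' \<oplus> x) = x"
    by (simp add: a_assoc [symmetric] r_neg)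
  then show ?thesis
    using nearring_ideal_left [OF I _ _ mem, of a x'] by simp
qed

section \<open>Subnearrings\<close>

lemma right_nearring_subnearring:
  assumes "subnearring S N"
  shows "right_nearring (N\<lparr>carrier := S\<rparr>)"
proof -
  have S: "subgroup S (add_monoid N)" and m: "\<And>a b. a \<in> S \<Longrightarrow> b \<in> S \<Longrightarrow> a \<otimes> b \<in> S"
    using assms by (auto simp: subnearring_def)
  have sub: "S \<subseteq> carrier N"
    using subgroup.subset [OF S] by simp
  have "group (add_monoid (N\<lparr>carrier := S\<rparr>))"
    using add.subgroup_imp_group [OF S] by simp
  then show ?thesis
    unfolding right_nearring_def right_nearring_axioms_def
    using m sub by (auto simp: subset_iff mult_assoc right_distrib)
qed

lemma subnearring_carrier: "subnearring (carrier N) N"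
  using add.subgroup_self by (auto simp: subnearring_def)

lemma subnearring_Inter:
  assumes "\<And>S. S \<in> \<S> \<Longrightarrow> subnearring S N" "\<S> \<noteq> {}"
  shows "subnearring (\<Inter>\<S>) N"
  using assms add.subgroups_Inter [of \<S>] by (auto simp: subnearring_def)

end

subsection \<open>Matrix nearrings\<close>

lemma right_nearring_maps_nearring:
  assumes "group G"
  shows "right_nearring (maps_nearring G)"
proof -
  interpret group G by fact
  \<comment> \<open>As an additive group, \<open>maps_nearring G\<close> is the direct power of
    \<open>G\<close> indexed by its own carrier, so the group axioms come from the product
    construction.\<close>
  have "add_monoid (maps_nearring G) = product_group (carrier G) (\<lambda>_. G)"
    by (simp add: maps_nearring_def product_group_def)
  then have "group (add_monoid (maps_nearring G))"
    using assms by simp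
  moreover have "compose (carrier G) (compose (carrier G) f g) h =
      compose (carrier G) f (compose (carrier G) g h)"
    if "h \<in> carrier G \<rightarrow>\<^sub>E carrier G" for f g h
    using that by (intro compose_assoc [symmetric, of _ _ "carrier G"]) (auto simp: PiE_iff)
  ultimately show ?thesis
    unfolding right_nearring_def right_nearring_axioms_def
    by (auto simp: maps_nearring_def compose_def PiE_iff Pi_iff fun_eq_iff)
qed

text \<open>The bound on \<open>n\<close> makes the index 1 available, on which corners and the
  vector \<open>e1\<close> rest.\<close>

locale matrices = right_nearring N + monoid N for N (structure) +
  fixes n :: nat
  assumes n_pos: "n \<ge> 1"
begin

declare One_nat_def [simp del] and n_pos [simp]

lemma one_in_range [simp]: "1 \<in> {1..n}"
  by simp

definition V where "V = {1..n} \<rightarrow>\<^sub>E carrier N"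

abbreviation M where "M \<equiv> matrix_nearring N n"
abbreviation E where "E \<equiv> elem_map N n"
abbreviation Maps where "Maps \<equiv> maps_nearring (power_group N n)"

lemma V_nth [simp]: "v \<in> V \<Longrightarrow> k \<in> {1..n} \<Longrightarrow> v k \<in> carrier N"
  by (auto simp: V_def PiE_iff)

lemma V_restrictI: "(\<And>k. k \<in> {1..n} \<Longrightarrow> f k \<in> carrier N) \<Longrightarrow> restrict f {1..n} \<in> V"
  by (auto simp: V_def)

lemma V_eqI:
  "v \<in> V \<Longrightarrow> w \<in> V \<Longrightarrow> (\<And>k. k \<in> {1..n} \<Longrightarrow> v k = w k) \<Longrightarrow> v = w"
  unfolding V_def by (rule PiE_ext)

lemma carrier_power_group: "carrier (power_group N n) = V"
  by (simp add: power_group_def V_def)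

lemma right_nearring_Maps: "right_nearring Maps"
  by (intro right_nearring_maps_nearring) (simp add: power_group_def add.is_group)

lemma E_in_Maps: "a \<in> carrier N \<Longrightarrow> j \<in> {1..n} \<Longrightarrow> E i j a \<in> carrier Maps"
  by (auto simp: elem_map_def maps_nearring_def carrier_power_group intro!: V_restrictI)

lemma matrix_nearring_eq: "M = Maps\<lparr>carrier := carrier M\<rparr>"
  by (simp add: matrix_nearring_def Let_def)

lemma carrier_matrix_nearring:
  "carrier M = \<Inter>{S. subnearring S Maps \<and> elem_maps N n (carrier N) \<subseteq> S}"
  by (simp add: matrix_nearring_def Let_def)

lemma subnearring_matrix_nearring: "subnearring (carrier M) Maps"
proof -
  interpret Maps: right_nearring Maps by (rule right_nearring_Maps)
  \<comment> \<open>The family being intersected is nonempty, since all maps together form a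
    subnearring containing the generators.\<close>
  have "carrier Maps \<in> {S. subnearring S Maps \<and> elem_maps N n (carrier N) \<subseteq> S}"
    using Maps.subnearring_carrier E_in_Maps by (auto simp: elem_maps_def)
  then show ?thesis
    unfolding carrier_matrix_nearring by (intro Maps.subnearring_Inter) auto
qed

sublocale M: right_nearring M
  using right_nearring.right_nearring_subnearring
    [OF right_nearring_Maps subnearring_matrix_nearring] matrix_nearring_eq
  by simp

lemma carrier_M_subset: "carrier M \<subseteq> V \<rightarrow>\<^sub>E V"
proof -
  have "carrier M \<subseteq> carrier Maps"
    using subnearring_matrix_nearring by (auto simp: subnearring_def subgroup_def)
  then show ?thesis
    by (simp add: maps_nearring_def carrier_power_group)
qed

lemma E_closed [simp, intro]:
  "a \<in> carrier N \<Longrightarrow> i \<in> {1..n} \<Longrightarrow> j \<in> {1..n} \<Longrightarrow> E i j a \<in> carrier M"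
  unfolding carrier_matrix_nearring elem_maps_def by blast

lemma apply_closed [simp]: "A \<in> carrier M \<Longrightarrow> v \<in> V \<Longrightarrow> A v \<in> V"
  using carrier_M_subset by blast

lemma apply_closed_nth [simp]:
  "A \<in> carrier M \<Longrightarrow> v \<in> V \<Longrightarrow> k \<in> {1..n} \<Longrightarrow> A v k \<in> carrier N"
  using V_nth [OF apply_closed] by blast

lemma matrix_eqI:
  assumes "A \<in> carrier M" "B \<in> carrier M"
    and "\<And>v k. v \<in> V \<Longrightarrow> k \<in> {1..n} \<Longrightarrow> A v k = B v k"
  shows "A = B"
proof (rule PiE_ext)
  show "A \<in> V \<rightarrow>\<^sub>E V" "B \<in> V \<rightarrow>\<^sub>E V"
    using assms carrier_M_subset by auto
qed (use assms in \<open>auto intro: V_eqI\<close>)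

lemma E_apply [simp]:
  "v \<in> V \<Longrightarrow> k \<in> {1..n} \<Longrightarrow> E i j a v k = (if k = i then a \<otimes> v j else \<zero>)"
  by (simp add: elem_map_def carrier_power_group)

lemma add_apply [simp]:
  "v \<in> V \<Longrightarrow> k \<in> {1..n} \<Longrightarrow> (A \<oplus>\<^bsub>M\<^esub> B) v k = A v k \<oplus> B v k"
  by (subst matrix_nearring_eq) (simp add: maps_nearring_def carrier_power_group, simp add: power_group_def)

lemma mult_apply [simp]: "v \<in> V \<Longrightarrow> (A \<otimes>\<^bsub>M\<^esub> B) v = A (B v)"
  by (subst matrix_nearring_eq) (simp add: maps_nearring_def carrier_power_group compose_def)

lemma zero_apply [simp]: "v \<in> V \<Longrightarrow> k \<in> {1..n} \<Longrightarrow> \<zero>\<^bsub>M\<^esub> v k = \<zero>"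
  by (subst matrix_nearring_eq) (simp add: maps_nearring_def carrier_power_group, simp add: power_group_def)

lemma uminus_apply [simp]:
  assumes "A \<in> carrier M" "v \<in> V" "k \<in> {1..n}"
  shows "(\<ominus>\<^bsub>M\<^esub> A) v k = \<ominus> (A v k)"
proof (rule minus_equality [symmetric])
  have "(\<ominus>\<^bsub>M\<^esub> A \<oplus>\<^bsub>M\<^esub> A) v k = \<zero>"
    using assms by (simp add: M.l_neg)
  then show "(\<ominus>\<^bsub>M\<^esub> A) v k \<oplus> A v k = \<zero>"
    using assms by simp
qed (use assms in auto)

lemma minus_apply [simp]:
  "A \<in> carrier M \<Longrightarrow> B \<in> carrier M \<Longrightarrow> v \<in> V \<Longrightarrow> k \<in> {1..n} \<Longrightarrow>
    (A \<ominus>\<^bsub>M\<^esub> B) v k = A v k \<ominus> B v k"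
  by (simp add: a_minus_def)

text \<open>The matrices with property \<open>P\<close> form a subnearring of \<open>Maps\<close>
  that contains the generators, hence contain the least such subnearring. An elementary matrix shows
  that this set is nonempty.\<close>

lemma matrix_induct [consumes 1, case_names elem add uminus mult]:
  assumes "A \<in> carrier M"
    and elem: "\<And>i j a. i \<in> {1..n} \<Longrightarrow> j \<in> {1..n} \<Longrightarrow> a \<in> carrier N \<Longrightarrow> P (E i j a)"
    and add: "\<And>A B. A \<in> carrier M \<Longrightarrow> B \<in> carrier M \<Longrightarrow> P A \<Longrightarrow> P B \<Longrightarrow> P (A \<oplus>\<^bsub>M\<^esub> B)"
    and uminus: "\<And>A. A \<in> carrier M \<Longrightarrow> P A \<Longrightarrow> P (\<ominus>\<^bsub>M\<^esub> A)"
    and mult: "\<And>A B. A \<in> carrier M \<Longrightarrow> B \<in> carrier M \<Longrightarrow> P A \<Longrightarrow> P B \<Longrightarrow> P (A \<otimes>\<^bsub>M\<^esub> B)"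
  shows "P A"
proof -
  interpret Maps: right_nearring Maps by (rule right_nearring_Maps)
  have sub: "subgroup (carrier M) (add_monoid Maps)"
    using subnearring_matrix_nearring by (simp add: subnearring_def)
  let ?S = "{A \<in> carrier M. P A}"
  have ops: "A \<oplus>\<^bsub>Maps\<^esub> B = A \<oplus>\<^bsub>M\<^esub> B" "A \<otimes>\<^bsub>Maps\<^esub> B = A \<otimes>\<^bsub>M\<^esub> B" for A B
    by (simp_all add: matrix_nearring_def Let_def)
  have inv: "inv\<^bsub>add_monoid Maps\<^esub> A = \<ominus>\<^bsub>M\<^esub> A" if "A \<in> carrier M" for A
    using Maps.add.m_inv_consistent [OF sub that]
    by (subst matrix_nearring_eq) (simp add: a_inv_def)
  have "subgroup ?S (add_monoid Maps)"
  proof (rule Maps.add.subgroupI)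
    show "?S \<subseteq> carrier (add_monoid Maps)"
      using subgroup.subset [OF sub] by auto
    show "?S \<noteq> {}"
      using elem [of 1 1 \<zero>] E_closed [of \<zero> 1 1] one_in_range zero_closed by blast
    fix A B assume A: "A \<in> ?S" and B: "B \<in> ?S"
    show "inv\<^bsub>add_monoid Maps\<^esub> A \<in> ?S"
      using A by (subst inv) (auto intro: uminus)
    show "A \<otimes>\<^bsub>add_monoid Maps\<^esub> B \<in> ?S"
      using A B by (auto simp: ops intro: add)
  qed
  then have "subnearring ?S Maps"
    by (auto simp: subnearring_def ops mult)
  moreover have "elem_maps N n (carrier N) \<subseteq> ?S"
    using elem by (auto simp: elem_maps_def)
  ultimately have "carrier M \<subseteq> ?S"
    unfolding carrier_matrix_nearring by blast
  then show ?thesis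
    using assms(1) by auto
qed

section \<open>Right scalar multiplication of vectors\<close>

definition scale where "scale v r = (\<lambda>k\<in>{1..n}. v k \<otimes> r)"

lemma scale_mem [simp]: "v \<in> V \<Longrightarrow> r \<in> carrier N \<Longrightarrow> scale v r \<in> V"
  unfolding scale_def by (rule V_restrictI) simp

lemma scale_nth [simp]: "k \<in> {1..n} \<Longrightarrow> scale v r k = v k \<otimes> r"
  by (simp add: scale_def)

text \<open>Associativity settles the elementary maps, right distributivity the sums and negatives.
  Matrices need not be additive maps; this homogeneity is what remains of linearity.\<close>

lemma matrix_scale:
  assumes "A \<in> carrier M" "v \<in> V" "r \<in> carrier N"
  shows "A (scale v r) = scale (A v) r"
  using assms(1,2)
proof (induction A arbitrary: v rule: matrix_induct)
  case (elem i j a)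
  then show ?case
    by (intro V_eqI) (use assms(3) in \<open>auto simp: mult_assoc\<close>)
next
  case (add A B)
  then show ?case
    by (intro V_eqI) (use assms(3) in \<open>auto simp: right_distrib\<close>)
next
  case (uminus A)
  then show ?case
    by (intro V_eqI) (use assms(3) in \<open>auto simp: minus_mult\<close>)
next
  case (mult A B)
  then show ?case
    using assms(3) by simp
qed

section \<open>Arithmetic of elementary matrices\<close>

lemma E_zero: "i \<in> {1..n} \<Longrightarrow> j \<in> {1..n} \<Longrightarrow> E i j \<zero> = \<zero>\<^bsub>M\<^esub>"
  by (rule matrix_eqI) auto

text \<open>For a general coefficient \<open>a\<close>, the product
  \<open>a \<otimes> \<zero>\<close> may differ from zero. The coefficient \<open>\<one>\<close>
  avoids this, so these matrices satisfy the premise of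
  \<open>nearring_ideal_left_mult\<close>.\<close>

lemma E_mult_zero [simp]:
  "i \<in> {1..n} \<Longrightarrow> j \<in> {1..n} \<Longrightarrow> E i j \<one> \<otimes>\<^bsub>M\<^esub> \<zero>\<^bsub>M\<^esub> = \<zero>\<^bsub>M\<^esub>"
  by (rule matrix_eqI) auto

lemma E_add:
  "i \<in> {1..n} \<Longrightarrow> j \<in> {1..n} \<Longrightarrow> a \<in> carrier N \<Longrightarrow> b \<in> carrier N \<Longrightarrow>
    E i j (a \<oplus> b) = E i j a \<oplus>\<^bsub>M\<^esub> E i j b"
  by (rule matrix_eqI) (auto simp: right_distrib)

lemma E_uminus:
  "i \<in> {1..n} \<Longrightarrow> j \<in> {1..n} \<Longrightarrow> a \<in> carrier N \<Longrightarrow> E i j (\<ominus> a) = \<ominus>\<^bsub>M\<^esub> (E i j a)"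
  by (rule matrix_eqI) (auto simp: minus_mult)

lemma E_minus:
  "i \<in> {1..n} \<Longrightarrow> j \<in> {1..n} \<Longrightarrow> a \<in> carrier N \<Longrightarrow> b \<in> carrier N \<Longrightarrow>
    E i j (a \<ominus> b) = E i j a \<ominus>\<^bsub>M\<^esub> E i j b"
  by (simp add: a_minus_def E_add E_uminus)

lemma E_mult:
  assumes "i \<in> {1..n}" "j \<in> {1..n}" "k \<in> {1..n}" "a \<in> carrier N" "b \<in> carrier N"
  shows "E i j a \<otimes>\<^bsub>M\<^esub> E j k b = E i k (a \<otimes> b)"
proof (rule matrix_eqI)
  fix v l assume "v \<in> V" "l \<in> {1..n}"
  moreover have "E j k b v \<in> V"
    using assms \<open>v \<in> V\<close> by simp
  ultimately show "(E i j a \<otimes>\<^bsub>M\<^esub> E j k b) v l = E i k (a \<otimes> b) v l"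
    using assms by (auto simp: mult_assoc)
qed (use assms in auto)

text \<open>Addition, negation and left multiplication in \<open>N\<close> preserve congruence
  modulo \<open>I\<close>, so induction over the generation of \<open>A\<close> applies. The vectors
  vary in the induction because composition feeds \<open>B v\<close> and \<open>B w\<close> to
  \<open>A\<close>.\<close>

lemma matrix_minus_mem:
  assumes I: "nearring_ideal I N" and "A \<in> carrier M" "v \<in> V" "w \<in> V"
    and "\<And>k. k \<in> {1..n} \<Longrightarrow> v k \<ominus> w k \<in> I" and "k \<in> {1..n}"
  shows "A v k \<ominus> A w k \<in> I"
  using assms(2-)
proof (induction A arbitrary: v w k rule: matrix_induct)
  case (elem i j a)
  then show ?case
    using nearring_ideal_zero [OF I] minus_mem_mult [OF I, of a "v j" "w j"]
    by auto
next
  case (add A B)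
  then show ?case
    by (simp add: minus_mem_add [OF I])
next
  case (uminus A)
  then show ?case
    by (simp add: minus_mem_uminus [OF I])
next
  case (mult A B)
  then show ?case
    by simp
qed

subsection \<open>Ideals of matrix nearrings\<close>

text \<open>The matrices sending all of N^n into I^n, often written (I^n : N^n). This ideal serves
  as an upper bound for \<open>ideal_plus N n I\<close>.\<close>

definition entrywise where
  "entrywise I = {A \<in> carrier M. \<forall>v\<in>V. \<forall>k\<in>{1..n}. A v k \<in> I}"

text \<open>The left condition is the one with content: adding \<open>C\<close> to \<open>B\<close>
  keeps each coordinate of the value in its class modulo \<open>I\<close>, and \<open>A\<close>
  respects such changes.\<close>

lemma nearring_ideal_entrywise:
  assumes I: "nearring_ideal I N"
  shows "nearring_ideal (entrywise I) M"
proof (rule M.nearring_idealI)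
  show "entrywise I \<subseteq> carrier M"
    by (auto simp: entrywise_def)
  fix A B C assume *: "A \<in> carrier M" "B \<in> carrier M" and C: "C \<in> entrywise I"
  have CM: "C \<in> carrier M"
    using C by (simp add: entrywise_def)
  have "A ((B \<oplus>\<^bsub>M\<^esub> C) v) k \<ominus> A (B v) k \<in> I" if v: "v \<in> V" and k: "k \<in> {1..n}" for v k
  proof (rule matrix_minus_mem [OF I, of A "(B \<oplus>\<^bsub>M\<^esub> C) v" "B v"])
    fix l assume l: "l \<in> {1..n}"
    with * C v have "B v l \<oplus> C v l \<ominus> B v l \<in> I"
      by (intro nearring_ideal_conj [OF I]) (auto simp: entrywise_def)
    then show "(B \<oplus>\<^bsub>M\<^esub> C) v l \<ominus> B v l \<in> I"
      using l v by simp
  qed (use * CM v k in simp_all)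
  with * CM show "A \<otimes>\<^bsub>M\<^esub> (B \<oplus>\<^bsub>M\<^esub> C) \<ominus>\<^bsub>M\<^esub> A \<otimes>\<^bsub>M\<^esub> B \<in> entrywise I"
    by (simp add: entrywise_def)
qed (simp_all add: entrywise_def nearring_ideal_zero [OF I] nearring_ideal_add [OF I]
    nearring_ideal_uminus [OF I] nearring_ideal_conj [OF I])

lemma
  assumes "I \<subseteq> carrier N"
  shows nearring_ideal_ideal_plus: "nearring_ideal (ideal_plus N n I) M"
    and elem_maps_subset_ideal_plus: "elem_maps N n I \<subseteq> ideal_plus N n I"
proof -
  have "elem_maps N n I \<subseteq> carrier M"
    using assms by (auto simp: elem_maps_def)
  then show "nearring_ideal (ideal_plus N n I) M"
    unfolding ideal_plus_def using M.nearring_ideal_carrier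
    by (intro M.nearring_ideal_Inter) auto
  show "elem_maps N n I \<subseteq> ideal_plus N n I"
    by (auto simp: ideal_plus_def)
qed

lemma E_mem_ideal_plus:
  assumes "I \<subseteq> carrier N" "i \<in> {1..n}" "j \<in> {1..n}" "x \<in> I"
  shows "E i j x \<in> ideal_plus N n I"
  using assms(2-4) elem_maps_subset_ideal_plus [OF assms(1)] unfolding elem_maps_def by blast

lemma ideal_plus_least:
  "nearring_ideal J M \<Longrightarrow> elem_maps N n I \<subseteq> J \<Longrightarrow> ideal_plus N n I \<subseteq> J"
  by (auto simp: ideal_plus_def)

lemma ideal_plus_mono:
  assumes "I \<subseteq> J"
  shows "ideal_plus N n I \<subseteq> ideal_plus N n J"
proof -
  have "elem_maps N n I \<subseteq> elem_maps N n J"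
    unfolding elem_maps_def using assms by blast
  then show ?thesis
    unfolding ideal_plus_def by (intro Inter_anti_mono) auto
qed

section \<open>The corner of a matrix ideal\<close>

definition corner where
  "corner Q = {x \<in> carrier N. E 1 1 x \<in> Q}"

lemma corner_mono: "Q \<subseteq> R \<Longrightarrow> corner Q \<subseteq> corner R"
  by (auto simp: corner_def)

text \<open>\<open>E 1 1\<close> is compatible with both operations, and the corner is the preimage
  of \<open>Q\<close> under this homomorphism from \<open>N\<close> to \<open>M\<close>.\<close>

lemma nearring_ideal_corner:
  assumes Q: "nearring_ideal Q M"
  shows "nearring_ideal (corner Q) N"
proof (rule nearring_idealI)
  note [simp] = E_add E_minus
  fix x y assume x: "x \<in> corner Q" and y: "y \<in> carrier N"
  then show "y \<oplus> x \<ominus> y \<in> corner Q"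
    using M.nearring_ideal_conj [OF Q, of "E 1 1 y" "E 1 1 x"] by (simp add: corner_def)
  have E11_mult: "E 1 1 (a \<otimes> b) = E 1 1 a \<otimes>\<^bsub>M\<^esub> E 1 1 b"
    if "a \<in> carrier N" "b \<in> carrier N" for a b
    using that by (simp add: E_mult)
  show "x \<otimes> y \<in> corner Q"
    using x y M.nearring_ideal_right [OF Q, of "E 1 1 x" "E 1 1 y"]
    by (simp add: corner_def E11_mult)
  fix z assume "z \<in> carrier N"
  with x y show "z \<otimes> (y \<oplus> x) \<ominus> z \<otimes> y \<in> corner Q"
    using M.nearring_ideal_left [OF Q, of "E 1 1 z" "E 1 1 y" "E 1 1 x"]
    by (simp add: corner_def E11_mult)
qed (auto simp: corner_def E_zero E_add E_uminus M.nearring_ideal_zero [OF Q]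
    M.nearring_ideal_add [OF Q] M.nearring_ideal_uminus [OF Q])

text \<open>Matrix units move the corner anywhere: \<open>E i j x\<close> is \<open>E 1 1 x\<close>
  multiplied by \<open>E i 1 \<one>\<close> on the left and by \<open>E 1 j \<one>\<close> on the
  right. The left factor kills zero, so \<open>Q\<close> absorbs it.\<close>

lemma elem_maps_corner_subset:
  assumes Q: "nearring_ideal Q M"
  shows "elem_maps N n (corner Q) \<subseteq> Q"
proof -
  have "E i j x \<in> Q" if ij: "i \<in> {1..n}" "j \<in> {1..n}" and x: "x \<in> carrier N" "E 1 1 x \<in> Q" for i j x
  proof -
    note 1 = one_in_range
    have "E i 1 \<one> \<otimes>\<^bsub>M\<^esub> E 1 1 x \<otimes>\<^bsub>M\<^esub> E 1 j \<one> \<in> Q"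
      using ij 1 x
      by (intro M.nearring_ideal_right [OF Q] M.nearring_ideal_left_mult [OF Q]) auto
    moreover have "E i 1 \<one> \<otimes>\<^bsub>M\<^esub> E 1 1 x \<otimes>\<^bsub>M\<^esub> E 1 j \<one> = E i j x"
      using ij 1 x by (simp add: E_mult)
    ultimately show ?thesis
      by simp
  qed
  then show ?thesis
    by (auto simp: elem_maps_def corner_def)
qed

lemma ideal_plus_corner_subset: "nearring_ideal Q M \<Longrightarrow> ideal_plus N n (corner Q) \<subseteq> Q"
  by (intro ideal_plus_least elem_maps_corner_subset)

definition e1 where "e1 = (\<lambda>k\<in>{1..n}. if k = 1 then \<one> else \<zero>)"

lemma e1_mem [simp]: "e1 \<in> V"
  unfolding e1_def by (rule V_restrictI) simp

lemma e1_nth [simp]: "k \<in> {1..n} \<Longrightarrow> e1 k = (if k = 1 then \<one> else \<zero>)"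
  by (simp add: e1_def)

text \<open>The ideal \<open>entrywise P\<close> contains the generators of
  \<open>ideal_plus N n P\<close> and hence all of it. Evaluating \<open>E 1 1 x\<close> at
  \<open>e1\<close> then exhibits \<open>x\<close> as an entry lying in \<open>P\<close>.\<close>

lemma corner_ideal_plus:
  assumes P: "nearring_ideal P N"
  shows "corner (ideal_plus N n P) = P"
proof
  note sub = nearring_ideal_subset [OF P]
  show "P \<subseteq> corner (ideal_plus N n P)"
    using E_mem_ideal_plus [OF sub one_in_range one_in_range] sub by (auto simp: corner_def)
  have "elem_maps N n P \<subseteq> entrywise P"
    using sub nearring_ideal_zero [OF P] nearring_ideal_right [OF P]
    by (auto simp: elem_maps_def entrywise_def subset_iff)
  then have le: "ideal_plus N n P \<subseteq> entrywise P"
    by (intro ideal_plus_least nearring_ideal_entrywise P)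
  show "corner (ideal_plus N n P) \<subseteq> P"
  proof
    fix x assume "x \<in> corner (ideal_plus N n P)"
    then have x: "x \<in> carrier N" "E 1 1 x \<in> entrywise P"
      using le by (auto simp: corner_def)
    then have "E 1 1 x e1 1 \<in> P"
      using e1_mem one_in_range unfolding entrywise_def by blast
    then show "x \<in> P"
      using x(1) by (simp del: atLeastAtMost_iff)
  qed
qed

text \<open>Compressing a matrix to the corner gives an elementary matrix, because matrices commute with
  scalar multiplication from the right.\<close>

lemma corner_compression:
  assumes A: "A \<in> carrier M"
  shows "E 1 1 \<one> \<otimes>\<^bsub>M\<^esub> A \<otimes>\<^bsub>M\<^esub> E 1 1 \<one> = E 1 1 (A e1 1)"
proof (rule matrix_eqI)
  note 1 = one_in_range
  show "E 1 1 \<one> \<otimes>\<^bsub>M\<^esub> A \<otimes>\<^bsub>M\<^esub> E 1 1 \<one> \<in> carrier M" "E 1 1 (A e1 1) \<in> carrier M"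
    using A 1 e1_mem by auto
  fix v k assume v: "v \<in> V" and k: "k \<in> {1..n}"
  have v1: "v 1 \<in> carrier N"
    using v 1 by auto
  have w: "E 1 1 \<one> v \<in> V"
    using v 1 by simp
  \<comment> \<open>Erasing all coordinates but the first leaves \<open>e1\<close> scaled by
    \<open>v 1\<close>, so that the scalar can be pulled through \<open>A\<close>.\<close>
  have eq: "E 1 1 \<one> v = scale e1 (v 1)"
    by (rule V_eqI) (use w v v1 in auto)
  have "A (E 1 1 \<one> v) 1 = A e1 1 \<otimes> v 1"
    unfolding eq using 1 by (simp add: matrix_scale [OF A e1_mem v1])
  moreover have "A (E 1 1 \<one> v) \<in> V"
    using A w by simp
  ultimately show "(E 1 1 \<one> \<otimes>\<^bsub>M\<^esub> A \<otimes>\<^bsub>M\<^esub> E 1 1 \<one>) v k = E 1 1 (A e1 1) v k"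
    using v k w 1 v1 A e1_mem by simp
qed

text \<open>Compression by \<open>E 1 1 \<one>\<close> on both sides keeps \<open>A\<close> in
  \<open>Q\<close> and turns it into the elementary matrix with coefficient
  \<open>A e1 1\<close>.\<close>

lemma apply_e1_mem_corner:
  assumes Q: "nearring_ideal Q M" and A: "A \<in> Q"
  shows "A e1 1 \<in> corner Q"
proof -
  note 1 = one_in_range
  have AM: "A \<in> carrier M"
    using A M.nearring_ideal_subset [OF Q] by auto
  have "E 1 1 \<one> \<otimes>\<^bsub>M\<^esub> A \<otimes>\<^bsub>M\<^esub> E 1 1 \<one> \<in> Q"
    using 1 A by (intro M.nearring_ideal_right [OF Q] M.nearring_ideal_left_mult [OF Q]) auto
  then show ?thesis
    using AM e1_mem 1 by (simp add: corner_compression corner_def)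
qed

section \<open>Pairs of ideals with full sum\<close>

lemma nearring_ideal_eq_carrier: "nearring_ideal I N \<Longrightarrow> \<one> \<in> I \<Longrightarrow> I = carrier N"
  using nearring_ideal_right [of I \<one>] nearring_ideal_subset [of I] by force

text \<open>A decomposition of \<open>E 1 1 \<one>\<close> is evaluated at \<open>e1\<close>. The
  first coordinate writes \<open>\<one>\<close> as a sum of elements of the two corners, and an
  ideal containing \<open>\<one>\<close> is everything.\<close>

lemma corner_set_add:
  assumes K: "nearring_ideal K M" and Q: "nearring_ideal Q M"
    and sum: "K <+>\<^bsub>M\<^esub> Q = carrier M"
  shows "corner K <+>\<^bsub>N\<^esub> corner Q = carrier N"
proof (rule nearring_ideal_eq_carrier)
  show "nearring_ideal (corner K <+>\<^bsub>N\<^esub> corner Q) N"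
    by (intro nearring_ideal_set_add nearring_ideal_corner K Q)
  note 1 = one_in_range
  then have "E 1 1 \<one> \<in> K <+>\<^bsub>M\<^esub> Q"
    by (simp add: sum)
  then obtain A B where AB: "A \<in> K" "B \<in> Q" and eq: "E 1 1 \<one> = A \<oplus>\<^bsub>M\<^esub> B"
    by (auto simp: set_add_def')
  have "A e1 1 \<oplus> B e1 1 = (A \<oplus>\<^bsub>M\<^esub> B) e1 1"
    using e1_mem 1 by simp
  also have "\<dots> = \<one>"
    unfolding eq [symmetric] using e1_mem 1 by simp
  finally show "\<one> \<in> corner K <+>\<^bsub>N\<^esub> corner Q"
    using apply_e1_mem_corner [OF K AB(1)] apply_e1_mem_corner [OF Q AB(2)]
    by (force simp: set_add_def')
qed

text \<open>The diagonal units sum to the identity on vectors, and an ideal containing this left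
  identity contains every matrix.\<close>

lemma matrix_ideal_eq_carrier:
  assumes I: "nearring_ideal I M" and diag: "\<And>i. i \<in> {1..n} \<Longrightarrow> E i i \<one> \<in> I"
  shows "I = carrier M"
proof -
  note sub = M.nearring_ideal_subset [OF I]
  \<comment> \<open>The sum is built one diagonal unit at a time; the partial sum up to
    \<open>m\<close> is the projection onto the first \<open>m\<close> coordinates. Indices start at
    1, so \<open>m = 0\<close> gives the zero matrix.\<close>
  have "\<exists>T\<in>I. \<forall>v\<in>V. \<forall>k\<in>{1..n}. T v k = (if k \<le> m then v k else \<zero>)" if "m \<le> n" for m
    using that
  proof (induction m)
    case 0
    then show ?case
      using M.nearring_ideal_zero [OF I] by (intro bexI [of _ "\<zero>\<^bsub>M\<^esub>"]) auto
  next
    case (Suc m)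
    then obtain T where T: "T \<in> I"
        "\<forall>v\<in>V. \<forall>k\<in>{1..n}. T v k = (if k \<le> m then v k else \<zero>)"
      by auto
    have E: "E (Suc m) (Suc m) \<one> \<in> I"
      using Suc.prems diag by simp
    show ?case
    proof (rule bexI, intro ballI)
      show "T \<oplus>\<^bsub>M\<^esub> E (Suc m) (Suc m) \<one> \<in> I"
        by (rule M.nearring_ideal_add [OF I T(1) E])
      fix v k assume "v \<in> V" "k \<in> {1..n}"
      then show "(T \<oplus>\<^bsub>M\<^esub> E (Suc m) (Suc m) \<one>) v k = (if k \<le> Suc m then v k else \<zero>)"
        using T(2) by auto
    qed
  qed
  from this [of n] obtain T where T: "T \<in> I" "\<forall>v\<in>V. \<forall>k\<in>{1..n}. T v k = v k"
    by auto
  have "A \<in> I" if A: "A \<in> carrier M" for A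
  proof -
    have "T \<otimes>\<^bsub>M\<^esub> A = A"
      using T sub A by (intro matrix_eqI) auto
    then show ?thesis
      using M.nearring_ideal_right [OF I T(1) A] by simp
  qed
  with sub show ?thesis
    by auto
qed

text \<open>Splitting \<open>\<one>\<close> as \<open>a \<oplus> b\<close> splits every diagonal
  unit, since \<open>E i i\<close> is additive in its coefficient.\<close>

lemma ideal_plus_set_add:
  assumes K: "nearring_ideal K N" and P: "nearring_ideal P N"
    and sum: "K <+>\<^bsub>N\<^esub> P = carrier N"
  shows "ideal_plus N n K <+>\<^bsub>M\<^esub> ideal_plus N n P = carrier M"
proof (rule matrix_ideal_eq_carrier)
  note sub = nearring_ideal_subset [OF K] nearring_ideal_subset [OF P]
  show "nearring_ideal (ideal_plus N n K <+>\<^bsub>M\<^esub> ideal_plus N n P) M"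
    by (intro M.nearring_ideal_set_add nearring_ideal_ideal_plus sub)
  have "\<one> \<in> K <+>\<^bsub>N\<^esub> P"
    by (simp add: sum)
  then obtain a b where ab: "a \<in> K" "b \<in> P" "\<one> = a \<oplus> b"
    by (auto simp: set_add_def')
  fix i assume i: "i \<in> {1..n}"
  have "E i i \<one> = E i i a \<oplus>\<^bsub>M\<^esub> E i i b"
    using ab i sub by (simp add: E_add subset_iff)
  moreover have "E i i a \<in> ideal_plus N n K" "E i i b \<in> ideal_plus N n P"
    using ab i sub by (simp_all add: E_mem_ideal_plus)
  ultimately show "E i i \<one> \<in> ideal_plus N n K <+>\<^bsub>M\<^esub> ideal_plus N n P"
    by (auto simp: set_add_def')
qed

section \<open>Transfer of supplements\<close>

text \<open>If \<open>P\<close> is a supplement of \<open>K\<close>, its lift is a supplement of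
  \<open>ideal_plus N n K\<close>. The corner of a competitor \<open>J\<close> competes with
  \<open>P\<close>, so minimality makes it equal to \<open>P\<close>; lifting it back puts the whole
  lift of \<open>P\<close> inside \<open>J\<close>.\<close>

lemma supplement_ideal_plus:
  assumes "supplement_ideal P N"
  shows "supplement_ideal (ideal_plus N n P) M"
proof -
  obtain K where K: "nearring_ideal K N" and P: "nearring_ideal P N"
    and sum: "K <+>\<^bsub>N\<^esub> P = carrier N"
    and min: "\<And>J. nearring_ideal J N \<Longrightarrow> J \<subseteq> P \<Longrightarrow> K <+>\<^bsub>N\<^esub> J = carrier N \<Longrightarrow> J = P"
    using assms by (auto simp: supplement_ideal_def is_supplement_def)
  have Kp: "nearring_ideal (ideal_plus N n K) M" and Pp: "nearring_ideal (ideal_plus N n P) M"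
    using K P nearring_ideal_subset nearring_ideal_ideal_plus by auto
  have "J = ideal_plus N n P"
    if J: "nearring_ideal J M" "J \<subseteq> ideal_plus N n P"
      and sumJ: "ideal_plus N n K <+>\<^bsub>M\<^esub> J = carrier M" for J
  proof -
    have "corner J = P"
    proof (rule min)
      show "corner J \<subseteq> P"
        using corner_mono [OF J(2)] by (simp add: corner_ideal_plus P)
      show "K <+>\<^bsub>N\<^esub> corner J = carrier N"
        using corner_set_add [OF Kp J(1) sumJ] by (simp add: corner_ideal_plus K)
    qed (rule nearring_ideal_corner [OF J(1)])
    then show ?thesis
      using ideal_plus_corner_subset [OF J(1)] J(2) by auto
  qed
  then show ?thesis
    using Kp Pp ideal_plus_set_add [OF K P sum]
    by (auto simp: supplement_ideal_def is_supplement_def)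
qed

lemma supplement_corner:
  assumes "supplement_ideal Q M"
  shows "supplement_ideal (corner Q) N" "ideal_plus N n (corner Q) = Q"
proof -
  obtain K where K: "nearring_ideal K M" and Q: "nearring_ideal Q M"
    and sum: "K <+>\<^bsub>M\<^esub> Q = carrier M"
    and min: "\<And>J. nearring_ideal J M \<Longrightarrow> J \<subseteq> Q \<Longrightarrow> K <+>\<^bsub>M\<^esub> J = carrier M \<Longrightarrow> J = Q"
    using assms by (auto simp: supplement_ideal_def is_supplement_def)
  \<comment> \<open>Used twice: for \<open>J = corner Q\<close> it recovers \<open>Q\<close> from
    its corner, and for a competitor \<open>J\<close> in \<open>N\<close>, taking corners of both
    sides gives \<open>J = corner Q\<close>.\<close>
  have lift: "ideal_plus N n J = Q"
    if J: "nearring_ideal J N" "J \<subseteq> corner Q" and sumJ: "corner K <+>\<^bsub>N\<^esub> J = carrier N" for J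
  proof (rule min)
    show Jp: "nearring_ideal (ideal_plus N n J) M"
      by (intro nearring_ideal_ideal_plus nearring_ideal_subset J)
    show "ideal_plus N n J \<subseteq> Q"
      using ideal_plus_mono [OF J(2)] ideal_plus_corner_subset [OF Q] by auto
    have "carrier M = ideal_plus N n (corner K) <+>\<^bsub>M\<^esub> ideal_plus N n J"
      by (rule ideal_plus_set_add [symmetric, OF nearring_ideal_corner [OF K] J(1) sumJ])
    also have "\<dots> \<subseteq> K <+>\<^bsub>M\<^esub> ideal_plus N n J"
      by (intro M.set_add_mono ideal_plus_corner_subset K) auto
    finally show "K <+>\<^bsub>M\<^esub> ideal_plus N n J = carrier M"
      using M.set_add_subset [OF K Jp] by auto
  qed
  have sumc: "corner K <+>\<^bsub>N\<^esub> corner Q = carrier N"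
    by (rule corner_set_add [OF K Q sum])
  show "ideal_plus N n (corner Q) = Q"
    by (rule lift [OF nearring_ideal_corner [OF Q] _ sumc]) simp
  have "J = corner Q"
    if "nearring_ideal J N" "J \<subseteq> corner Q" "corner K <+>\<^bsub>N\<^esub> J = carrier N" for J
    using lift [OF that] corner_ideal_plus [OF that(1)] by simp
  then show "supplement_ideal (corner Q) N"
    using nearring_ideal_corner K Q sumc by (auto simp: supplement_ideal_def is_supplement_def)
qed

end

theorem theorem3p17:
  fixes N :: "('a, 'm) ring_scheme" and n :: nat
  assumes "right_nearring N" and "monoid N" and "n \<ge> 1"
  shows "bij_betw (ideal_plus N n)
           {P. supplement_ideal P N}
           {Q. supplement_ideal Q (matrix_nearring N n)}"
proof -
  interpret matrices N n
    using assms by (simp add: matrices_def matrices_axioms_def)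
  show ?thesis
  proof (rule bij_betw_byWitness [where f' = corner])
    show "\<forall>P\<in>{P. supplement_ideal P N}. corner (ideal_plus N n P) = P"
      using corner_ideal_plus by (auto simp: supplement_ideal_def is_supplement_def)
    show "\<forall>Q\<in>{Q. supplement_ideal Q M}. ideal_plus N n (corner Q) = Q"
      using supplement_corner(2) by blast
    show "ideal_plus N n ` {P. supplement_ideal P N} \<subseteq> {Q. supplement_ideal Q M}"
      using supplement_ideal_plus by blast
    show "corner ` {Q. supplement_ideal Q M} \<subseteq> {P. supplement_ideal P N}"
      using supplement_corner(1) by blast
  qed
qed

end
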